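(* Let $\Theta$ be such that $\textsf{SFF}(\Theta)$. There is a functional $G:\mathbb{N}^{\mathbb{N}}\to\mathbb{N}$ computable in $\exists^2$ such that $\Theta(G)$ is not hyperarithmetical.
   Context: The metatheory is $\textsf{ZFC}$ and functionals live in the full (set-theoretic) type structure over $\mathbb{N}$. "Computable" (in given functionals) means Kleene computable via the schemes S1–S9. For $f\in\mathbb{N}^{\mathbb{N}}$, $\overline{f}N=\langle f(0),\dots,f(N-1)\rangle$; for a finite sequence $\sigma$, $f\in[\sigma]$ means $f$ extends $\sigma$. A functional $\Theta$ of type $2\to1^*$ assigns to every $G:\mathbb{N}^{\mathbb{N}}\to\mathbb{N}$ a finite sequence $\Theta(G)=\langle f_0,\dots,f_k\rangle$ of elements of $\mathbb{N}^{\mathbb{N}}$. $\textsf{SFF}(\Theta)$ ("$\Theta$ is a special fan functional") is the statement: for all $G:\mathbb{N}^{\mathbb{N}}\to\mathbb{N}$ and all $f\in2^{\mathbb{N}}$ there is an entry $g$ of $\Theta(G)$ with $f\in[\overline{g}G(g)]$. $\exists^2:\mathbb{N}^{\mathbb{N}}\to\{0,1\}$ is the functional with $\exists^2(f)=0$ if and only if $(\exists n)(f(n)=0)$. A function $f:\mathbb{N}\to\mathbb{N}$ is hyperarithmetical if its graph is (lightface) $\Delta^1_1$ (equivalently $f$ is computable in $\exists^2$); a finite sequence of functions is hyperarithmetical if all its entries are. *)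

theory Defs
  imports "HOL-Library.Nat_Bijection"
begin

type_synonym baire = "nat \<Rightarrow> nat"
type_synonym type2 = "baire \<Rightarrow> nat"


section \<open>Special fan functionals\<close>

definition initial_segment :: "baire \<Rightarrow> nat \<Rightarrow> nat list" where
  "initial_segment f N = map f [0..<N]"

definition neighbourhood :: "nat list \<Rightarrow> baire set" where
  "neighbourhood \<sigma> = {f. \<forall>i<length \<sigma>. f i = \<sigma> ! i}"

definition cantor :: "baire set" where
  "cantor = {f. \<forall>n. f n \<in> {0, 1}}"

definition SFF :: "(type2 \<Rightarrow> baire list) \<Rightarrow> bool" where
  "SFF \<Theta> \<longleftrightarrow>
     (\<forall>G. \<forall>f\<in>cantor. \<exists>g\<in>set (\<Theta> G). f \<in> neighbourhood (initial_segment g (G g)))"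


section \<open>Kleene computability\<close>

text \<open>
  Kleene's schemes S1--S9 for arguments of types 0, 1 and 2, grouped by type into three lists.
  Higher argument types never occur in a computation that starts with arguments of these types:
  S8 applied to an argument of type 2 only adds a number argument.

  \<open>kleene e xs fs Fs y\<close> means that \<open>{e}(xs, fs, Fs)\<close> terminates with value \<open>y\<close>. An index is the
  code of a finite list of numbers whose head is the number of the scheme. Indices do not record
  the numbers of arguments of the various types; one index may be used with argument lists of
  different lengths.
\<close>

definition to_front :: "nat \<Rightarrow> 'a list \<Rightarrow> 'a list" where
  "to_front k xs = xs ! k # take k xs @ drop (Suc k) xs"

inductive kleene :: "nat \<Rightarrow> nat list \<Rightarrow> baire list \<Rightarrow> type2 list \<Rightarrow> nat \<Rightarrow> bool" where
  S1: "kleene (list_encode [1]) (x # xs) fs Fs (Suc x)"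
| S2: "kleene (list_encode [2, q]) xs fs Fs q"
| S3: "kleene (list_encode [3]) (x # xs) fs Fs x"
| S4: "kleene h xs fs Fs z \<Longrightarrow> kleene g (z # xs) fs Fs y
         \<Longrightarrow> kleene (list_encode [4, g, h]) xs fs Fs y"
| S5_0: "kleene g xs fs Fs y \<Longrightarrow> kleene (list_encode [5, g, h]) (0 # xs) fs Fs y"
| S5_Suc: "kleene (list_encode [5, g, h]) (x # xs) fs Fs z
         \<Longrightarrow> kleene h (x # z # xs) fs Fs y
         \<Longrightarrow> kleene (list_encode [5, g, h]) (Suc x # xs) fs Fs y"
| S6_0: "k < length xs \<Longrightarrow> kleene g (to_front k xs) fs Fs y
         \<Longrightarrow> kleene (list_encode [6, 0, k, g]) xs fs Fs y"
| S6_1: "k < length fs \<Longrightarrow> kleene g xs (to_front k fs) Fs y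
         \<Longrightarrow> kleene (list_encode [6, 1, k, g]) xs fs Fs y"
| S6_2: "k < length Fs \<Longrightarrow> kleene g xs fs (to_front k Fs) y
         \<Longrightarrow> kleene (list_encode [6, 2, k, g]) xs fs Fs y"
| S7: "kleene (list_encode [7]) (x # xs) (f # fs) Fs (f x)"
| S8: "(\<And>n. kleene h (n # xs) fs (F # Fs) (u n))
         \<Longrightarrow> kleene (list_encode [8, h]) xs fs (F # Fs) (F u)"
| S9: "i \<le> length xs \<Longrightarrow> j \<le> length fs \<Longrightarrow> k \<le> length Fs
         \<Longrightarrow> kleene e (take i xs) (take j fs) (take k Fs) y
         \<Longrightarrow> kleene (list_encode [9, i, j, k]) (e # xs) fs Fs y"

definition computable_in :: "type2 \<Rightarrow> type2 \<Rightarrow> bool" where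
  "computable_in G H \<longleftrightarrow> (\<exists>e. \<forall>f. kleene e [] [f] [H] (G f))"

definition E2 :: type2 where
  "E2 f = (if \<exists>n. f n = 0 then 0 else 1)"


section \<open>Hyperarithmetical functions\<close>

text \<open>
  Arithmetical formulas of second-order arithmetic with number variables and function variables,
  both named by natural numbers; only number quantifiers occur.
\<close>

datatype aterm =
    Var nat
  | Zero
  | Succ aterm
  | Plus aterm aterm
  | Times aterm aterm
  | App nat aterm

datatype aform =
    Equal aterm aterm
  | Neg aform
  | Conj aform aform
  | Exists nat aform

primrec value_of :: "(nat \<Rightarrow> baire) \<Rightarrow> (nat \<Rightarrow> nat) \<Rightarrow> aterm \<Rightarrow> nat" where
  "value_of X v (Var i) = v i"
| "value_of X v Zero = 0"
| "value_of X v (Succ t) = Suc (value_of X v t)"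
| "value_of X v (Plus s t) = value_of X v s + value_of X v t"
| "value_of X v (Times s t) = value_of X v s * value_of X v t"
| "value_of X v (App i t) = X i (value_of X v t)"

primrec sat :: "(nat \<Rightarrow> baire) \<Rightarrow> (nat \<Rightarrow> nat) \<Rightarrow> aform \<Rightarrow> bool" where
  "sat X v (Equal s t) \<longleftrightarrow> value_of X v s = value_of X v t"
| "sat X v (Neg \<phi>) \<longleftrightarrow> \<not> sat X v \<phi>"
| "sat X v (Conj \<phi> \<psi>) \<longleftrightarrow> sat X v \<phi> \<and> sat X v \<psi>"
| "sat X v (Exists i \<phi>) \<longleftrightarrow> (\<exists>a. sat X (v(i := a)) \<phi>)"

text \<open>
  The quantifier over \<open>X\<close> is a block of existential function quantifiers, one for each of
  the finitely many function variables of \<open>\<phi>\<close>. There are no function or number parameters: number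
  variables 0 and 1 hold the two arguments of the relation, every other free one is read as 0.
\<close>

definition Sigma11 :: "(nat \<times> nat) set \<Rightarrow> bool" where
  "Sigma11 R \<longleftrightarrow>
     (\<exists>\<phi>. \<forall>m n. (m, n) \<in> R \<longleftrightarrow> (\<exists>X. sat X ((\<lambda>_. 0)(0 := m, 1 := n)) \<phi>))"

definition Pi11 :: "(nat \<times> nat) set \<Rightarrow> bool" where
  "Pi11 R \<longleftrightarrow> Sigma11 (- R)"

definition Delta11 :: "(nat \<times> nat) set \<Rightarrow> bool" where
  "Delta11 R \<longleftrightarrow> Sigma11 R \<and> Pi11 R"

definition hyperarithmetical :: "baire \<Rightarrow> bool" where
  "hyperarithmetical f \<longleftrightarrow> Delta11 {(m, n). f m = n}"

definition hyperarithmetical_seq :: "baire list \<Rightarrow> bool" where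
  "hyperarithmetical_seq fs \<longleftrightarrow> (\<forall>f\<in>set fs. hyperarithmetical f)"

end

theory Submission
  imports Defs
begin

text \<open>
  For nodes of a tree whose well-founded part is \<open>\<Pi>\<^sup>1\<^sub>1\<close>-complete, comparison of ranks is the relation
  determined by the recursion ``\<open>x \<le> y\<close> iff every child of \<open>x\<close> is \<open>\<le>\<close> some child of \<open>y\<close>''. On pairs with
  at least one well-founded component it has no hyperarithmetical solution, by diagonalization.
  So a hyperarithmetical \<open>g\<close>, read as a relation, violates the recursion at some well-founded node,
  and below the least rank at which this happens \<open>g\<close> compares ranks correctly. Therefore \<open>g\<close> itself
  can be used to recognize, arithmetically in \<open>g\<close>, a violation at this least rank, and at such a pair
  \<open>g\<close> differs from the true comparison. Let \<open>G g\<close> exceed the code of such a pair. Then no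
  hyperarithmetical \<open>g\<close> has the characteristic function of the true comparison in its
  neighbourhood of size \<open>G g\<close>, so \<open>\<Theta> G\<close> must have a non-hyperarithmetical entry.
\<close>

section \<open>Comparing ranks in the well-founded part of a relation\<close>

text \<open>Taking the least solution of the recursion makes the relation fail at every ill-founded
  \<open>x\<close>, while an ill-founded \<open>y\<close> lies above all well-founded
  points.\<close>

inductive rank_le :: "('a \<Rightarrow> 'a \<Rightarrow> bool) \<Rightarrow> 'a \<Rightarrow> 'a \<Rightarrow> bool" for R where
  rank_leI: "(\<And>u. R u x \<Longrightarrow> \<exists>v. R v y \<and> rank_le R u v) \<Longrightarrow> rank_le R x y"

lemma rank_le_iff: "rank_le R x y \<longleftrightarrow> (\<forall>u. R u x \<longrightarrow> (\<exists>v. R v y \<and> rank_le R u v))"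
  by (subst rank_le.simps) blast

lemma rank_le_accp: "rank_le R x y \<Longrightarrow> Wellfounded.accp R x"
  by (induction rule: rank_le.induct) (blast intro: accp.accI)

lemma rank_le_refl: "Wellfounded.accp R x \<Longrightarrow> rank_le R x x"
  by (induction rule: accp.induct) (blast intro: rank_leI)

lemma rank_le_trans: "rank_le R x y \<Longrightarrow> rank_le R y z \<Longrightarrow> rank_le R x z"
proof (induction arbitrary: z rule: rank_le.induct)
  case (rank_leI x y)
  show ?case
  proof (rule rank_le.rank_leI)
    fix u assume "R u x"
    then obtain v where "R v y" and IH: "\<And>w. rank_le R v w \<Longrightarrow> rank_le R u w"
      using rank_leI.IH by blast
    then show "\<exists>w. R w z \<and> rank_le R u w"
      using rank_leI.prems unfolding rank_le_iff[of R y] by blast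
  qed
qed

lemma rank_le_child: "Wellfounded.accp R x \<Longrightarrow> R u x \<Longrightarrow> rank_le R u x"
  by (induction arbitrary: u rule: accp.induct) (blast intro: rank_leI)

text \<open>If a child \<open>u\<close> of \<open>x\<close> is below no child of \<open>y\<close>,
  then by induction every child of \<open>y\<close> is below some child of \<open>u\<close>, so
  \<open>y\<close> is below \<open>u\<close>. The second alternative expresses that \<open>y\<close>
  has strictly smaller rank.\<close>

lemma rank_le_or_less:
  "Wellfounded.accp R x \<Longrightarrow> rank_le R x y \<or> (\<exists>u. R u x \<and> rank_le R y u)"
proof (induction arbitrary: y rule: accp.induct)
  case (accI x)
  show ?case
  proof (rule disjCI)
    assume "\<nexists>u. R u x \<and> rank_le R y u"
    then have "\<exists>v. R v y \<and> rank_le R u v" if "R u x" for u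
      using accI.IH[OF that] that unfolding rank_le_iff[of R y] by blast
    then show "rank_le R x y"
      by (rule rank_leI)
  qed
qed

lemma rank_minimal:
  assumes "Wellfounded.accp R x" "Q x"
  obtains z where "Wellfounded.accp R z" "Q z" "\<And>u w. R u z \<Longrightarrow> rank_le R w u \<Longrightarrow> \<not> Q w"
proof -
  \<comment> \<open>The induction is on a bound \<open>x\<close> with \<open>y\<close> arbitrary,
    because a point of smaller rank satisfying \<open>Q\<close> need not be a descendant of
    \<open>y\<close>.\<close>
  have "\<exists>z. Wellfounded.accp R z \<and> Q z \<and> (\<forall>u w. R u z \<longrightarrow> rank_le R w u \<longrightarrow> \<not> Q w)"
    if "rank_le R y x" "Q y" for y
    using assms(1) that
  proof (induction arbitrary: y rule: accp.induct)
    case (accI x)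
    show ?case
    proof (cases "\<exists>u w. R u y \<and> rank_le R w u \<and> Q w")
      case True
      then obtain u w where "R u y" "rank_le R w u" "Q w" by blast
      moreover obtain v where "R v x" "rank_le R u v"
        using \<open>R u y\<close> accI.prems(1) unfolding rank_le_iff[of R y] by blast
      ultimately show ?thesis
        using accI.IH rank_le_trans[of R w u v] by blast
    next
      case False
      then show ?thesis
        using accI.prems rank_le_accp[of R y x] by blast
    qed
  qed
  then show thesis
    using that assms rank_le_refl[of R x] by blast
qed

text \<open>
  A relation \<open>F\<close> is tested as a candidate for \<open>rank_le R\<close> through the recursion that characterizes
  the latter. If \<open>F\<close> fails somewhere in the well-founded part, then the pivots are exactly the
  points whose rank is at most the least rank of a bad point.
\<close>

definition rank_step :: "('a \<Rightarrow> 'a \<Rightarrow> bool) \<Rightarrow> ('a \<Rightarrow> 'a \<Rightarrow> bool) \<Rightarrow> 'a \<Rightarrow> 'a \<Rightarrow> bool" where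
  "rank_step R F x y \<longleftrightarrow> (\<forall>u. R u x \<longrightarrow> (\<exists>v. R v y \<and> F u v))"

definition fails :: "('a \<Rightarrow> 'a \<Rightarrow> bool) \<Rightarrow> ('a \<Rightarrow> 'a \<Rightarrow> bool) \<Rightarrow> 'a \<Rightarrow> 'a \<Rightarrow> bool" where
  "fails R F x y \<longleftrightarrow> F x y \<noteq> rank_step R F x y"

definition bad :: "('a \<Rightarrow> 'a \<Rightarrow> bool) \<Rightarrow> ('a \<Rightarrow> 'a \<Rightarrow> bool) \<Rightarrow> 'a \<Rightarrow> bool" where
  "bad R F x \<longleftrightarrow> (\<exists>y. fails R F x y \<or> fails R F y x)"

text \<open>\<open>rank_step\<close> replaces \<open>F\<close> here: at the least bad rank
  \<open>F\<close> may be wrong, but one step of the recursion consults only children, where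
  \<open>F\<close> is still right.\<close>

definition pivot :: "('a \<Rightarrow> 'a \<Rightarrow> bool) \<Rightarrow> ('a \<Rightarrow> 'a \<Rightarrow> bool) \<Rightarrow> 'a \<Rightarrow> bool" where
  "pivot R F x \<longleftrightarrow> (\<forall>z. bad R F z \<longrightarrow> rank_step R F x z)"

text \<open>At a good \<open>w\<close> the recursion reduces \<open>F w y\<close> and
  \<open>F y w\<close> to pairs with a child of \<open>w\<close> as one component, so well-founded
  induction settles both for arbitrary \<open>y\<close>.\<close>

lemma agree_on_good:
  assumes "Wellfounded.accp R w" "w \<in> D"
    and good: "\<And>w. w \<in> D \<Longrightarrow> \<not> bad R F w"
    and down: "\<And>u w. w \<in> D \<Longrightarrow> R u w \<Longrightarrow> u \<in> D"
  shows "F w y \<longleftrightarrow> rank_le R w y" "F y w \<longleftrightarrow> rank_le R y w"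
proof -
  have "\<forall>y. (F w y \<longleftrightarrow> rank_le R w y) \<and> (F y w \<longleftrightarrow> rank_le R y w)"
    using assms(1,2)
  proof (induction rule: accp.induct)
    case (accI x)
    have IH: "F u y \<longleftrightarrow> rank_le R u y" "F y u \<longleftrightarrow> rank_le R y u" if "R u x" for u y
      using accI.IH[OF that] down[OF accI.prems that] by simp_all
    have "F x y = rank_step R F x y" "F y x = rank_step R F y x" for y
      using good[OF accI.prems] by (auto simp: bad_def fails_def)
    then show ?case
      unfolding rank_step_def rank_le_iff[of R x] rank_le_iff[of R _ x]
      using IH by (simp cong: conj_cong)
  qed
  then show "F w y \<longleftrightarrow> rank_le R w y" "F y w \<longleftrightarrow> rank_le R y w"
    by blast+
qed

text \<open>Take a bad \<open>z\<close> of least rank. One step of the recursion from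
  \<open>F\<close> is correct as soon as one component has rank at most that of \<open>z\<close>.
  All pivots have such a rank, \<open>z\<close> is a pivot, and failing at a pivot means differing
  from \<open>rank_le\<close>.\<close>

lemma
  assumes "Wellfounded.accp R x0" "bad R F x0"
  shows pivot_exists: "\<exists>x y. fails R F x y \<and> (pivot R F x \<or> pivot R F y)"
    and pivot_fails: "fails R F x y \<Longrightarrow> pivot R F x \<or> pivot R F y \<Longrightarrow> F x y \<noteq> rank_le R x y"
proof -
  obtain z where z: "Wellfounded.accp R z" "bad R F z" "\<And>u w. R u z \<Longrightarrow> rank_le R w u \<Longrightarrow> \<not> bad R F w"
    using rank_minimal[of R x0 "bad R F"] assms by blast
  \<comment> \<open>The points of rank strictly below that of \<open>z\<close>, all good by
    minimality.\<close>
  define D where "D = {w. \<exists>u. R u z \<and> rank_le R w u}"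
  have agree: "F w y \<longleftrightarrow> rank_le R w y" "F y w \<longleftrightarrow> rank_le R y w" if "w \<in> D" for w y
  proof -
    have acc: "Wellfounded.accp R w"
      using that rank_le_accp[of R w] unfolding D_def by auto
    have good: "\<not> bad R F w" if "w \<in> D" for w
      using that z(3) unfolding D_def by blast
    have down: "u \<in> D" if "w \<in> D" "R u w" for u w
    proof -
      obtain v where v: "R v z" "rank_le R w v"
        using \<open>w \<in> D\<close> unfolding D_def by blast
      have "rank_le R u w"
        by (rule rank_le_child[OF rank_le_accp[OF v(2)] \<open>R u w\<close>])
      then show ?thesis
        using v(1) rank_le_trans[OF _ v(2)] unfolding D_def by blast
    qed
    show "F w y \<longleftrightarrow> rank_le R w y" "F y w \<longleftrightarrow> rank_le R y w"
      using agree_on_good[of R w D F, OF acc that] good down by blast+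
  qed
  have D_child: "u \<in> D" if "rank_le R x z" "R u x" for u x
    using that unfolding D_def rank_le_iff[of R x] by simp
  have step: "rank_step R F x y \<longleftrightarrow> rank_le R x y" "rank_step R F y x \<longleftrightarrow> rank_le R y x"
    if "rank_le R x z" for x y
  proof -
    have *: "F u v \<longleftrightarrow> rank_le R u v" "F v u \<longleftrightarrow> rank_le R v u" if "R u x" for u v
      using agree D_child[OF \<open>rank_le R x z\<close> that] by simp_all
    show "rank_step R F x y \<longleftrightarrow> rank_le R x y" "rank_step R F y x \<longleftrightarrow> rank_le R y x"
      unfolding rank_step_def rank_le_iff[of R x y] rank_le_iff[of R y x] using * by (simp_all cong: conj_cong)
  qed
  have z_le: "rank_le R z z"
    by (rule rank_le_refl[OF z(1)])
  have le_pivot: "rank_le R x z" if "pivot R F x" for x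
    using that z(2) step(2)[OF z_le, of x] by (simp add: pivot_def)
  have "pivot R F z"
    unfolding pivot_def
  proof (intro allI impI)
    fix w assume "bad R F w"
    \<comment> \<open>Otherwise \<open>w\<close> would be below a child of \<open>z\<close> and
      hence good.\<close>
    then show "rank_step R F z w"
      using rank_le_or_less[OF z(1), of w] z(3) step(1)[OF z_le] by blast
  qed
  then show "\<exists>x y. fails R F x y \<and> (pivot R F x \<or> pivot R F y)"
    using z(2) unfolding bad_def by blast
  show "F x y \<noteq> rank_le R x y" if "fails R F x y" "pivot R F x \<or> pivot R F y"
    using that le_pivot step unfolding fails_def by blast
qed


section \<open>Total functions computable in \<open>E2\<close>\<close>

text \<open>
  The argument \<open>v\<close> is an infinite de Bruijn environment. Allowing an arbitrary placement \<open>\<pi>\<close> of the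
  variables in the list of number arguments makes the notion stable under weakening, which the
  schemes do not provide directly.
\<close>

definition computable :: "((nat \<Rightarrow> nat) \<Rightarrow> baire \<Rightarrow> nat) \<Rightarrow> bool" where
  "computable t \<longleftrightarrow> (\<forall>k \<pi>. (\<forall>i. \<pi> i < k) \<longrightarrow>
     (\<exists>e. \<forall>xs f. length xs = k \<longrightarrow> kleene e xs [f] [E2] (t (\<lambda>i. xs ! \<pi> i) f)))"

definition decidable :: "((nat \<Rightarrow> nat) \<Rightarrow> baire \<Rightarrow> bool) \<Rightarrow> bool" where
  "decidable P \<longleftrightarrow> computable (\<lambda>v f. if P v f then 0 else 1)"

lemma computableI:
  assumes "\<And>k \<pi>. (\<And>i. \<pi> i < k) \<Longrightarrow>
    \<exists>e. \<forall>xs f. length xs = k \<longrightarrow> kleene e xs [f] [E2] (t (\<lambda>i. xs ! \<pi> i) f)"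
  shows "computable t"
  using assms unfolding computable_def by blast

lemma computableE:
  assumes "computable t" "\<And>i. \<pi> i < k"
  obtains e where
    "\<And>xs f. length xs = k \<Longrightarrow> kleene e xs [f] [E2] (t (\<lambda>i. xs ! \<pi> i) f)"
  using assms unfolding computable_def by blast

lemma kleene_nth: "i < length xs \<Longrightarrow> kleene (list_encode [6, 0, i, list_encode [3]]) xs fs Fs (xs ! i)"
  by (rule S6_0) (simp_all del: list_encode.simps add: to_front_def S3)

section \<open>Closure under substitution, primitive recursion and arithmetic\<close>

lemma computable_var: "computable (\<lambda>v f. v i)"
  by (rule computableI) (use kleene_nth in blast)

lemma computable_const: "computable (\<lambda>v f. c)"
  by (rule computableI) (use S2 in blast)

lemma computable_subst1:
  assumes g: "computable (\<lambda>v f. g (v 0) f)" and a: "computable a"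
  shows "computable (\<lambda>v f. g (a v f) f)"
proof (rule computableI)
  fix k and \<pi> :: "nat \<Rightarrow> nat" assume \<pi>: "\<And>i. \<pi> i < k"
  obtain ea where ea: "\<And>xs f. length xs = k \<Longrightarrow> kleene ea xs [f] [E2] (a (\<lambda>i. xs ! \<pi> i) f)"
    using computableE[of a \<pi> k, OF a \<pi>] by blast
  obtain eg where "\<And>xs f. length xs = Suc k \<Longrightarrow> kleene eg xs [f] [E2] (g (xs ! 0) f)"
    using computableE[of _ "\<lambda>_. 0" "Suc k", OF g] by auto
  from this[of "_ # _"]
  have eg: "length xs = k \<Longrightarrow> kleene eg (x # xs) [f] [E2] (g x f)" for x xs f
    by simp
  show "\<exists>e. \<forall>xs f. length xs = k \<longrightarrow>
      kleene e xs [f] [E2] (g (a (\<lambda>i. xs ! \<pi> i) f) f)"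
    using S4[OF ea eg] by blast
qed

lemma computable_subst2:
  assumes g: "computable (\<lambda>v f. g (v 0) (v (Suc 0)) f)" and a: "computable a" and b: "computable b"
  shows "computable (\<lambda>v f. g (a v f) (b v f) f)"
proof (rule computableI)
  fix k and \<pi> :: "nat \<Rightarrow> nat" assume \<pi>: "\<And>i. \<pi> i < k"
  obtain eb where eb: "\<And>xs f. length xs = k \<Longrightarrow> kleene eb xs [f] [E2] (b (\<lambda>i. xs ! \<pi> i) f)"
    using computableE[of b \<pi> k, OF b \<pi>] by blast
  \<comment> \<open>The value of \<open>b\<close> is prepended first, so \<open>a\<close> is
    compiled for longer lists with all positions shifted by one.\<close>
  have "Suc (\<pi> i) < Suc k" for i
    using \<pi> by simp
  then obtain ea where "\<And>xs f. length xs = Suc k \<Longrightarrow>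
      kleene ea xs [f] [E2] (a (\<lambda>i. xs ! Suc (\<pi> i)) f)"
    using computableE[of a "\<lambda>i. Suc (\<pi> i)" "Suc k", OF a] by blast
  from this[of "_ # _"]
  have ea: "length xs = k \<Longrightarrow> kleene ea (x # xs) [f] [E2] (a (\<lambda>i. xs ! \<pi> i) f)" for x xs f
    by simp
  have "(if i = 0 then 0 else 1) < Suc (Suc k)" for i :: nat
    by simp
  then obtain eg where "\<And>xs f. length xs = Suc (Suc k) \<Longrightarrow>
      kleene eg xs [f] [E2] (g (xs ! 0) (xs ! 1) f)"
    using computableE[of _ "\<lambda>i. if i = 0 then 0 else 1" "Suc (Suc k)", OF g] by auto
  from this[of "_ # _ # _"]
  have eg: "length xs = k \<Longrightarrow> kleene eg (x # y # xs) [f] [E2] (g x y f)" for x y xs f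
    by simp
  show "\<exists>e. \<forall>xs f. length xs = k \<longrightarrow>
      kleene e xs [f] [E2] (g (a (\<lambda>i. xs ! \<pi> i) f) (b (\<lambda>i. xs ! \<pi> i) f) f)"
    using S4[OF eb S4[OF ea eg]] by blast
qed

lemma computable_rec:
  assumes n: "computable n" and a: "computable a"
    and h: "computable (\<lambda>v f. h (v 0) (v (Suc 0)) (\<lambda>i. v (Suc (Suc i))) f)"
  shows "computable (\<lambda>v f. rec_nat (a v f) (\<lambda>x z. h x z v f) (n v f))"
proof (rule computableI)
  fix k and \<pi> :: "nat \<Rightarrow> nat" assume \<pi>: "\<And>i. \<pi> i < k"
  obtain en where en: "\<And>xs f. length xs = k \<Longrightarrow> kleene en xs [f] [E2] (n (\<lambda>i. xs ! \<pi> i) f)"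
    using computableE[of n \<pi> k, OF n \<pi>] by blast
  obtain ea where ea: "\<And>xs f. length xs = k \<Longrightarrow> kleene ea xs [f] [E2] (a (\<lambda>i. xs ! \<pi> i) f)"
    using computableE[of a \<pi> k, OF a \<pi>] by blast
  \<comment> \<open>S5 puts the counter and the previous value in front of the old
    arguments.\<close>
  define \<pi>' where "\<pi>' = case_nat 0 (case_nat 1 (\<lambda>i. Suc (Suc (\<pi> i))))"
  have "\<pi>' i < Suc (Suc k)" for i
    using \<pi> by (simp add: \<pi>'_def split: nat.split)
  then obtain eh where "\<And>xs f. length xs = Suc (Suc k) \<Longrightarrow>
      kleene eh xs [f] [E2] (h (xs ! \<pi>' 0) (xs ! \<pi>' (Suc 0)) (\<lambda>i. xs ! \<pi>' (Suc (Suc i))) f)"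
    using computableE[of _ \<pi>' "Suc (Suc k)", OF h] by blast
  from this[of "_ # _ # _"]
  have eh: "length xs = k \<Longrightarrow> kleene eh (x # z # xs) [f] [E2] (h x z (\<lambda>i. xs ! \<pi> i) f)" for x z xs f
    by (simp add: \<pi>'_def)
  have rec: "kleene (list_encode [5, ea, eh]) (m # xs) [f] [E2]
      (rec_nat (a (\<lambda>i. xs ! \<pi> i) f) (\<lambda>x z. h x z (\<lambda>i. xs ! \<pi> i) f) m)"
    if "length xs = k" for m xs f
  proof (induction m)
    case 0
    show ?case
      using S5_0[OF ea[OF that]] by (simp only: nat.rec)
  next
    case (Suc m)
    show ?case
      using S5_Suc[OF Suc.IH eh[OF that]] by (simp only: nat.rec)
  qed
  show "\<exists>e. \<forall>xs f. length xs = k \<longrightarrow> kleene e xs [f] [E2]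
      (rec_nat (a (\<lambda>i. xs ! \<pi> i) f) (\<lambda>x z. h x z (\<lambda>i. xs ! \<pi> i) f) (n (\<lambda>i. xs ! \<pi> i) f))"
    using S4[OF en rec] by blast
qed

lemma computable_apply: "computable a \<Longrightarrow> computable (\<lambda>v f. f (a v f))"
proof (rule computable_subst1[where g = "\<lambda>x f. f x"], rule computableI)
  fix k and \<pi> :: "nat \<Rightarrow> nat" assume \<pi>: "\<And>i. \<pi> i < k"
  show "\<exists>e. \<forall>xs f. length xs = k \<longrightarrow> kleene e xs [f] [E2] (f (xs ! \<pi> 0))"
    by (intro exI allI impI, rule S4[OF kleene_nth S7]) (simp add: \<pi>)
qed

lemma computable_Suc: "computable a \<Longrightarrow> computable (\<lambda>v f. Suc (a v f))"
proof (rule computable_subst1[where g = "\<lambda>x f. Suc x"], rule computableI)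
  fix k and \<pi> :: "nat \<Rightarrow> nat" assume \<pi>: "\<And>i. \<pi> i < k"
  show "\<exists>e. \<forall>xs f. length xs = k \<longrightarrow> kleene e xs [f] [E2] (Suc (xs ! \<pi> 0))"
    by (intro exI allI impI, rule S4[OF kleene_nth S1]) (simp add: \<pi>)
qed

lemma computable_add: "computable a \<Longrightarrow> computable b \<Longrightarrow> computable (\<lambda>v f. a v f + b v f)"
proof (rule computable_subst2[where g = "\<lambda>x y f. x + y"])
  have *: "rec_nat y (\<lambda>x z. Suc z) x = x + y" for x y :: nat
    by (induction x) auto
  have "computable (\<lambda>v f. rec_nat (v (Suc 0)) (\<lambda>x z. Suc z) (v 0))"
    by (intro computable_rec computable_Suc computable_var)
  then show "computable (\<lambda>v f. v 0 + v (Suc 0))"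
    by (simp add: *)
qed

lemma computable_mult: "computable a \<Longrightarrow> computable b \<Longrightarrow> computable (\<lambda>v f. a v f * b v f)"
proof (rule computable_subst2[where g = "\<lambda>x y f. x * y"])
  have *: "rec_nat 0 (\<lambda>x z. z + y) x = x * y" for x y :: nat
    by (induction x) auto
  have "computable (\<lambda>v f. rec_nat 0 (\<lambda>x z. z + v (Suc 0)) (v 0))"
    by (intro computable_rec computable_add computable_var computable_const)
  then show "computable (\<lambda>v f. v 0 * v (Suc 0))"
    by (simp add: *)
qed

lemma computable_power2: "computable a \<Longrightarrow> computable (\<lambda>v f. 2 ^ a v f)"
proof (rule computable_subst1[where g = "\<lambda>x f. 2 ^ x"])
  have *: "rec_nat 1 (\<lambda>x z. z + z) x = (2::nat) ^ x" for x :: nat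
    by (induction x) auto
  have "computable (\<lambda>v f. rec_nat 1 (\<lambda>x z. z + z) (v 0))"
    by (intro computable_rec computable_add computable_var computable_const)
  then show "computable (\<lambda>v f. 2 ^ v 0)"
    unfolding * .
qed

lemma computable_prod_encode: "computable a \<Longrightarrow> computable b \<Longrightarrow> computable (\<lambda>v f. prod_encode (a v f, b v f))"
proof -
  have *: "rec_nat 0 (\<lambda>x z. z + Suc x) x = triangle x" for x
    by (induction x) auto
  have "computable (\<lambda>v f. rec_nat 0 (\<lambda>x z. z + Suc x) (v 0))"
    by (intro computable_rec computable_add computable_Suc computable_var computable_const)
  then have tri: "computable (\<lambda>v f. triangle (v 0))"
    unfolding * .
  show "computable a \<Longrightarrow> computable b \<Longrightarrow> computable (\<lambda>v f. prod_encode (a v f, b v f))"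
    unfolding prod_encode_def prod.case
    by (intro computable_add computable_subst1[where g = "\<lambda>x f. triangle x", OF tri])
qed

section \<open>Decidable relations and number quantifiers\<close>

lemma decidable_zero: "computable a \<Longrightarrow> decidable (\<lambda>v f. a v f = 0)"
  unfolding decidable_def
proof (rule computable_subst1[where g = "\<lambda>x f. if x = 0 then 0 else 1"])
  have *: "rec_nat 0 (\<lambda>x z. 1) x = (if x = 0 then 0 else 1)" for x :: nat
    by (cases x) auto
  have "computable (\<lambda>v f. rec_nat 0 (\<lambda>x z. 1) (v 0))"
    by (intro computable_rec computable_var computable_const)
  then show "computable (\<lambda>v f. if v 0 = 0 then 0 else 1)"
    unfolding * .
qed

lemma decidable_not: "decidable P \<Longrightarrow> decidable (\<lambda>v f. \<not> P v f)"
proof -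
  have *: "rec_nat 1 (\<lambda>x z. 0) (if P then 0 else 1) = (if \<not> P then 0 else (1::nat))" for P
    by auto
  assume "decidable P"
  then have "computable (\<lambda>v f. rec_nat 1 (\<lambda>x z. 0) (if P v f then 0 else 1))"
    unfolding decidable_def by (intro computable_rec computable_const)
  then show "decidable (\<lambda>v f. \<not> P v f)"
    unfolding decidable_def * .
qed

lemma decidable_conj: "decidable P \<Longrightarrow> decidable Q \<Longrightarrow> decidable (\<lambda>v f. P v f \<and> Q v f)"
proof -
  assume "decidable P" "decidable Q"
  then have "decidable (\<lambda>v f. (if P v f then 0 else 1) + (if Q v f then 0 else 1) = (0::nat))"
    unfolding decidable_def[of P] decidable_def[of Q] by (intro decidable_zero computable_add)
  moreover have "((if P v f then 0 else 1) + (if Q v f then 0 else 1) = (0::nat)) \<longleftrightarrow> P v f \<and> Q v f"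
    for v f by simp
  ultimately show ?thesis by simp
qed

lemma decidable_disj: "decidable P \<Longrightarrow> decidable Q \<Longrightarrow> decidable (\<lambda>v f. P v f \<or> Q v f)"
  using decidable_not[OF decidable_conj[OF decidable_not decidable_not, of P Q]]
  unfolding de_Morgan_conj not_not .

lemma decidable_imp: "decidable P \<Longrightarrow> decidable Q \<Longrightarrow> decidable (\<lambda>v f. P v f \<longrightarrow> Q v f)"
  using decidable_disj[OF decidable_not, of P Q] unfolding imp_conv_disj .

lemma decidable_iff: "decidable P \<Longrightarrow> decidable Q \<Longrightarrow> decidable (\<lambda>v f. P v f = Q v f)"
  using decidable_conj[OF decidable_imp decidable_imp, of P Q Q P] unfolding iff_conv_conj_imp .

lemma decidable_eq: "computable a \<Longrightarrow> computable b \<Longrightarrow> decidable (\<lambda>v f. a v f = b v f)"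
proof -
  have *: "rec_nat 0 (\<lambda>x z. x) x = x - 1" for x :: nat
    by (cases x) auto
  have "computable (\<lambda>v f. rec_nat 0 (\<lambda>x z. x) (v 0))"
    by (intro computable_rec computable_var computable_const)
  then have pred: "computable (\<lambda>v f. v 0 - 1)"
    unfolding * .
  have **: "rec_nat x (\<lambda>_ z. z - 1) y = x - y" for x y :: nat
    by (induction y) auto
  have "computable (\<lambda>v f. rec_nat (v 0) (\<lambda>_ z. z - 1) (v (Suc 0)))"
    by (intro computable_rec computable_var computable_subst1[where g = "\<lambda>x f. x - 1", OF pred])
  then have sub: "computable (\<lambda>v f. v 0 - v (Suc 0))"
    unfolding ** .
  assume "computable a" "computable b"
  then have "decidable (\<lambda>v f. (a v f - b v f) + (b v f - a v f) = 0)"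
    by (intro decidable_zero computable_add computable_subst2[where g = "\<lambda>x y f. x - y", OF sub])
  moreover have "((a v f - b v f) + (b v f - a v f) = 0) \<longleftrightarrow> a v f = b v f" for v f
    by auto
  ultimately show ?thesis by simp
qed

text \<open>S8 applies \<open>E2\<close> to the characteristic function of the matrix; 0 stands for
  truth in \<open>decidable\<close> just as in \<open>E2\<close>.\<close>

lemma decidable_ex:
  assumes "decidable (\<lambda>v f. P (v 0) (\<lambda>i. v (Suc i)) f)"
  shows "decidable (\<lambda>v f. \<exists>a. P a v f)"
  unfolding decidable_def
proof (rule computableI)
  fix k and \<pi> :: "nat \<Rightarrow> nat" assume \<pi>: "\<And>i. \<pi> i < k"
  define \<pi>' where "\<pi>' = case_nat 0 (\<lambda>i. Suc (\<pi> i))"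
  have "\<pi>' i < Suc k" for i
    using \<pi> by (simp add: \<pi>'_def split: nat.split)
  then obtain e where "\<And>xs f. length xs = Suc k \<Longrightarrow>
      kleene e xs [f] [E2] (if P (xs ! \<pi>' 0) (\<lambda>i. xs ! \<pi>' (Suc i)) f then 0 else 1)"
    using computableE[of _ \<pi>' "Suc k", OF assms[unfolded decidable_def]] by blast
  from this[of "_ # _"]
  have e: "length xs = k \<Longrightarrow>
      kleene e (a # xs) [f] [E2] (if P a (\<lambda>i. xs ! \<pi> i) f then 0 else 1)" for a xs f
    by (simp add: \<pi>'_def)
  have *: "E2 (\<lambda>a. if Q a then 0 else 1) = (if \<exists>a. Q a then 0 else 1)" for Q
    by (auto simp: E2_def)
  show "\<exists>e. \<forall>xs f. length xs = k \<longrightarrow>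
      kleene e xs [f] [E2] (if \<exists>a. P a (\<lambda>i. xs ! \<pi> i) f then 0 else 1)"
    using S8[where F = E2, OF e] unfolding * by blast
qed

lemma decidable_all:
  assumes "decidable (\<lambda>v f. P (v 0) (\<lambda>i. v (Suc i)) f)"
  shows "decidable (\<lambda>v f. \<forall>a. P a v f)"
  using decidable_not[OF decidable_ex[where P = "\<lambda>a v f. \<not> P a v f"], OF decidable_not[OF assms]] by simp

lemma decidable_subst1:
  "decidable (\<lambda>v f. P (v 0) f) \<Longrightarrow> computable a \<Longrightarrow> decidable (\<lambda>v f. P (a v f) f)"
  unfolding decidable_def by (rule computable_subst1[where g = "\<lambda>x f. if P x f then 0 else 1"])

lemma decidable_subst2:
  "decidable (\<lambda>v f. P (v 0) (v (Suc 0)) f) \<Longrightarrow> computable a \<Longrightarrow> computable b \<Longrightarrow> decidable (\<lambda>v f. P (a v f) (b v f) f)"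
  unfolding decidable_def by (rule computable_subst2[where g = "\<lambda>x y f. if P x y f then 0 else 1"])

lemmas computable_intros =
  computable_prod_encode computable_power2 computable_mult computable_add computable_Suc computable_apply computable_var computable_const
  decidable_ex decidable_all decidable_iff decidable_imp decidable_disj decidable_conj decidable_not decidable_eq

text \<open>
  Unbounded search runs an index \<open>s\<close> that receives itself as its first argument and calls itself
  through S9.
\<close>

lemma computable_in_Least:
  assumes P: "decidable (\<lambda>v f. P (v 0) f)" and ex: "\<And>f. \<exists>n. P n f"
  shows "computable_in (\<lambda>f. LEAST n. P n f) E2"
proof -
  obtain d where "\<And>xs f. length xs = Suc (Suc 0) \<Longrightarrow>
      kleene d xs [f] [E2] (if P (xs ! 1) f then 0 else 1)"
    using computableE[of _ "\<lambda>_. 1" "Suc (Suc 0)", OF P[unfolded decidable_def]] by auto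
  from this[of "[_, _]"]
  have d: "kleene d [e, x] [f] [E2] (if P x f then 0 else 1)" for e x f
    by simp
  define ret where "ret = list_encode [6, 0, 1, list_encode [3]]"
  \<comment> \<open>Run on \<open>[a, z, e, x]\<close>: compute \<open>Suc x\<close>, fetch
    \<open>e\<close>, duplicate it by S3, and let S9 run \<open>e\<close> on the two numbers
    \<open>e\<close> and \<open>Suc x\<close>.\<close>
  define nxt where "nxt = list_encode [4, list_encode [4, list_encode [4, list_encode [9, 2, 1, 1],
    list_encode [3]], list_encode [6, 0, 3, list_encode [3]]],
    list_encode [4, list_encode [1], list_encode [6, 0, 3, list_encode [3]]]]"
  \<comment> \<open>Recursion on the value of \<open>d\<close> is a case distinction: 0 returns
    \<open>x\<close>, and only 1 leads to the recursive call.\<close>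
  define s where "s = list_encode [4, list_encode [5, ret, nxt], d]"
  have ret: "kleene ret [e, x] [f] [E2] x" for e x f
    unfolding ret_def using kleene_nth[of 1 "[e, x]"] by simp
  have nxt: "kleene nxt [a, z, e, x] [f] [E2] y" if "kleene e [e, Suc x] [f] [E2] y" for a z e x f y
    unfolding nxt_def
  proof (rule S4[where z = "Suc x"])
    show "kleene (list_encode [4, list_encode [1], list_encode [6, 0, 3, list_encode [3]]])
        [a, z, e, x] [f] [E2] (Suc x)"
      by (rule S4[OF _ S1]) (use kleene_nth[of 3 "[a, z, e, x]"] in simp)
    show "kleene (list_encode [4, list_encode [4, list_encode [9, 2, 1, 1], list_encode [3]],
        list_encode [6, 0, 3, list_encode [3]]]) [Suc x, a, z, e, x] [f] [E2] y"
    proof (rule S4[where z = e])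
      show "kleene (list_encode [6, 0, 3, list_encode [3]]) [Suc x, a, z, e, x] [f] [E2] e"
        using kleene_nth[of 3 "[Suc x, a, z, e, x]"] by simp
      show "kleene (list_encode [4, list_encode [9, 2, 1, 1], list_encode [3]])
          [e, Suc x, a, z, e, x] [f] [E2] y"
        by (rule S4[OF S3], rule S9) (use that in \<open>simp_all del: list_encode.simps\<close>)
    qed
  qed
  \<comment> \<open>Downward induction from the least solution \<open>y\<close>.\<close>
  have s: "kleene s [s, x] [f] [E2] y" if "x \<le> y" "P y f" "\<And>z. z < y \<Longrightarrow> \<not> P z f" for x y f
    using that(1)
  proof (induction rule: inc_induct)
    case base
    have "kleene (list_encode [5, ret, nxt]) [0, s, y] [f] [E2] y"
      by (rule S5_0, rule ret)
    then show ?case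
      using S4[OF d, of "list_encode [5, ret, nxt]" y f s y] that(2) by (simp add: s_def)
  next
    case (step x)
    have "kleene (list_encode [5, ret, nxt]) [Suc 0, s, x] [f] [E2] y"
      by (rule S5_Suc, rule S5_0, rule ret, rule nxt, rule step.IH)
    then show ?case
      using S4[OF d, of "list_encode [5, ret, nxt]" x f s y] that(3)[OF step.hyps(2)] by (simp add: s_def)
  qed
  have "kleene (list_encode [4, list_encode [4, s, list_encode [2, s]], list_encode [2, 0]])
      [] [f] [E2] (LEAST n. P n f)" for f
    by (rule S4[OF S2], rule S4[OF S2], rule s)
      (use LeastI_ex[OF ex] not_less_Least in auto)
  then show ?thesis
    unfolding computable_in_def by blast
qed


section \<open>A tree of attempts to satisfy an arithmetical formula\<close>

abbreviation pair :: "nat \<Rightarrow> nat \<Rightarrow> nat" where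
  "pair m n \<equiv> prod_encode (m, n)"

text \<open>Tag 0 is kept for the function variables; nonzero tags make the codes of parts smaller
  than the code of the whole.\<close>

primrec term_code :: "aterm \<Rightarrow> nat" where
  "term_code (Var i) = pair 1 i"
| "term_code Zero = pair 2 0"
| "term_code (Succ t) = pair 3 (term_code t)"
| "term_code (Plus s t) = pair 4 (pair (term_code s) (term_code t))"
| "term_code (Times s t) = pair 5 (pair (term_code s) (term_code t))"
| "term_code (App i t) = pair 6 (pair i (term_code t))"

primrec form_code :: "aform \<Rightarrow> nat" where
  "form_code (Equal s t) = pair 7 (pair (term_code s) (term_code t))"
| "form_code (Neg \<phi>) = pair 8 (form_code \<phi>)"
| "form_code (Conj \<phi> \<psi>) = pair 9 (pair (form_code \<phi>) (form_code \<psi>))"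
| "form_code (Exists i \<phi>) = pair 10 (pair i (form_code \<phi>))"

text \<open>Environments are association lists under \<open>list_encode\<close>; the first entry for
  a variable counts, and 0 is the default value.\<close>

abbreviation env_cons :: "nat \<Rightarrow> nat \<Rightarrow> nat \<Rightarrow> nat" where
  "env_cons i a e \<equiv> Suc (pair (pair i a) e)"

definition env_val :: "nat \<Rightarrow> nat \<Rightarrow> nat" where
  "env_val e = foldr (\<lambda>p v. v(fst (prod_decode p) := snd (prod_decode p))) (list_decode e) (\<lambda>_. 0)"

lemma env_val_0: "env_val 0 = (\<lambda>_. 0)"
  by (simp add: env_val_def)

lemma env_val_cons: "env_val (env_cons i a e) = (env_val e)(i := a)"
  by (simp add: env_val_def)

section \<open>Correct evaluations\<close>

text \<open>
  An evaluation is a function \<open>h\<close> that sends \<open>pair c e\<close> to the value of the term or the truth value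
  of the formula with code \<open>c\<close> in the environment \<open>e\<close>; for an existential formula the truth value
  is 0 or the successor of a witness. The values \<open>h (pair (pair 0 i) a)\<close> interpret the function
  variable \<open>i\<close>. An evaluation is correct if its graph contains no three points that violate one
  of the recursive clauses for the semantics of formulas.
\<close>

definition violates :: "nat \<Rightarrow> nat \<Rightarrow> nat \<Rightarrow> bool" where
  "violates p q r \<longleftrightarrow>
     (\<exists>i c. p = pair (pair (pair 1 i) 0) c \<and> c \<noteq> 0) \<or>
     (\<exists>i j a e c d. p = pair (pair (pair 1 i) (env_cons j a e)) c \<and> q = pair (pair (pair 1 i) e) d
        \<and> (i = j \<and> c \<noteq> a \<or> i \<noteq> j \<and> c \<noteq> d)) \<or>
     (\<exists>e c. p = pair (pair (pair 2 0) e) c \<and> c \<noteq> 0) \<or>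
     (\<exists>s e c a. p = pair (pair (pair 3 s) e) c \<and> q = pair (pair s e) a \<and> c \<noteq> Suc a) \<or>
     (\<exists>s t e c a b. p = pair (pair (pair 4 (pair s t)) e) c \<and> q = pair (pair s e) a
        \<and> r = pair (pair t e) b \<and> c \<noteq> a + b) \<or>
     (\<exists>s t e c a b. p = pair (pair (pair 5 (pair s t)) e) c \<and> q = pair (pair s e) a
        \<and> r = pair (pair t e) b \<and> c \<noteq> a * b) \<or>
     (\<exists>i t e c a b. p = pair (pair (pair 6 (pair i t)) e) c \<and> q = pair (pair t e) a
        \<and> r = pair (pair (pair 0 i) a) b \<and> c \<noteq> b) \<or>
     (\<exists>s t e c a b. p = pair (pair (pair 7 (pair s t)) e) c \<and> q = pair (pair s e) a
        \<and> r = pair (pair t e) b \<and> (c \<noteq> 0) \<noteq> (a = b)) \<or>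
     (\<exists>s e c a. p = pair (pair (pair 8 s) e) c \<and> q = pair (pair s e) a \<and> (c \<noteq> 0) \<noteq> (a = 0)) \<or>
     (\<exists>s t e c a b. p = pair (pair (pair 9 (pair s t)) e) c \<and> q = pair (pair s e) a
        \<and> r = pair (pair t e) b \<and> (c \<noteq> 0) \<noteq> (a \<noteq> 0 \<and> b \<noteq> 0)) \<or>
     (\<exists>i s e c k a. p = pair (pair (pair 10 (pair i s)) e) c \<and> q = pair (pair s (env_cons i k e)) a
        \<and> (c = 0 \<and> a \<noteq> 0 \<or> c = Suc k \<and> a = 0))"

text \<open>Incorrectness has to show in finitely many points. The stored witness ensures this for
  existential formulas: a wrong value, be it 0 or \<open>Suc k\<close>, is refuted by a single
  instance.\<close>

definition consistent :: "nat set \<Rightarrow> bool" where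
  "consistent S \<longleftrightarrow> (\<forall>p\<in>S. \<forall>q\<in>S. \<forall>r\<in>S. \<not> violates p q r)"

definition graph :: "baire \<Rightarrow> nat set" where
  "graph h = range (\<lambda>q. pair q (h q))"

lemma consistent_graph:
  "consistent (graph h) \<longleftrightarrow>
    (\<forall>x y z. \<not> violates (pair x (h x)) (pair y (h y)) (pair z (h z)))"
  unfolding consistent_def graph_def by blast

lemma consistent_graphD:
  assumes "consistent (graph h)"
  shows "h (pair (pair 1 i) 0) = 0"
    and "h (pair (pair 1 i) (env_cons j a e)) = (if i = j then a else h (pair (pair 1 i) e))"
    and "h (pair (pair 2 0) e) = 0"
    and "h (pair (pair 3 s) e) = Suc (h (pair s e))"
    and "h (pair (pair 4 (pair s t)) e) = h (pair s e) + h (pair t e)"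
    and "h (pair (pair 5 (pair s t)) e) = h (pair s e) * h (pair t e)"
    and "h (pair (pair 6 (pair i t)) e) = h (pair (pair 0 i) (h (pair t e)))"
    and "h (pair (pair 7 (pair s t)) e) \<noteq> 0 \<longleftrightarrow> h (pair s e) = h (pair t e)"
    and "h (pair (pair 8 s) e) \<noteq> 0 \<longleftrightarrow> h (pair s e) = 0"
    and "h (pair (pair 9 (pair s t)) e) \<noteq> 0 \<longleftrightarrow> h (pair s e) \<noteq> 0 \<and> h (pair t e) \<noteq> 0"
    and "h (pair (pair 10 (pair i s)) e) = 0 \<Longrightarrow> h (pair s (env_cons i k e)) = 0"
    and "h (pair (pair 10 (pair i s)) e) = Suc k \<Longrightarrow> h (pair s (env_cons i k e)) \<noteq> 0"
proof -
  have no: "\<not> violates (pair x (h x)) (pair y (h y)) (pair z (h z))" for x y z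
    using assms unfolding consistent_graph by blast
  show "h (pair (pair 1 i) 0) = 0"
    using no[of "pair (pair 1 i) 0"] by (auto simp: violates_def split: if_splits)
  show "h (pair (pair 1 i) (env_cons j a e)) = (if i = j then a else h (pair (pair 1 i) e))"
    using no[of "pair (pair 1 i) (env_cons j a e)" "pair (pair 1 i) e"] by (auto simp: violates_def split: if_splits)
  show "h (pair (pair 2 0) e) = 0"
    using no[of "pair (pair 2 0) e"] by (auto simp: violates_def split: if_splits)
  show "h (pair (pair 3 s) e) = Suc (h (pair s e))"
    using no[of "pair (pair 3 s) e" "pair s e"] by (auto simp: violates_def split: if_splits)
  show "h (pair (pair 4 (pair s t)) e) = h (pair s e) + h (pair t e)"
    using no[of "pair (pair 4 (pair s t)) e" "pair s e" "pair t e"] by (auto simp: violates_def split: if_splits)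
  show "h (pair (pair 5 (pair s t)) e) = h (pair s e) * h (pair t e)"
    using no[of "pair (pair 5 (pair s t)) e" "pair s e" "pair t e"] by (auto simp: violates_def split: if_splits)
  show "h (pair (pair 6 (pair i t)) e) = h (pair (pair 0 i) (h (pair t e)))"
    using no[of "pair (pair 6 (pair i t)) e" "pair t e" "pair (pair 0 i) (h (pair t e))"] by (auto simp: violates_def split: if_splits)
  show "h (pair (pair 7 (pair s t)) e) \<noteq> 0 \<longleftrightarrow> h (pair s e) = h (pair t e)"
    using no[of "pair (pair 7 (pair s t)) e" "pair s e" "pair t e"] by (auto simp: violates_def split: if_splits)
  show "h (pair (pair 8 s) e) \<noteq> 0 \<longleftrightarrow> h (pair s e) = 0"
    using no[of "pair (pair 8 s) e" "pair s e"] by (auto simp: violates_def split: if_splits)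
  show "h (pair (pair 9 (pair s t)) e) \<noteq> 0 \<longleftrightarrow> h (pair s e) \<noteq> 0 \<and> h (pair t e) \<noteq> 0"
    using no[of "pair (pair 9 (pair s t)) e" "pair s e" "pair t e"] by (auto simp: violates_def split: if_splits)
  show "h (pair s (env_cons i k e)) = 0" if "h (pair (pair 10 (pair i s)) e) = 0"
    using that no[of "pair (pair 10 (pair i s)) e" "pair s (env_cons i k e)"] by (auto simp: violates_def)
  show "h (pair s (env_cons i k e)) \<noteq> 0" if "h (pair (pair 10 (pair i s)) e) = Suc k"
    using that no[of "pair (pair 10 (pair i s)) e" "pair s (env_cons i k e)"] by (auto simp: violates_def)
qed

lemma consistent_graphI:
  assumes "\<And>i. h (pair (pair 1 i) 0) = 0"
    and "\<And>i j a e. h (pair (pair 1 i) (env_cons j a e)) = (if i = j then a else h (pair (pair 1 i) e))"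
    and "\<And>e. h (pair (pair 2 0) e) = 0"
    and "\<And>s e. h (pair (pair 3 s) e) = Suc (h (pair s e))"
    and "\<And>s t e. h (pair (pair 4 (pair s t)) e) = h (pair s e) + h (pair t e)"
    and "\<And>s t e. h (pair (pair 5 (pair s t)) e) = h (pair s e) * h (pair t e)"
    and "\<And>i t e. h (pair (pair 6 (pair i t)) e) = h (pair (pair 0 i) (h (pair t e)))"
    and "\<And>s t e. h (pair (pair 7 (pair s t)) e) \<noteq> 0 \<longleftrightarrow> h (pair s e) = h (pair t e)"
    and "\<And>s e. h (pair (pair 8 s) e) \<noteq> 0 \<longleftrightarrow> h (pair s e) = 0"
    and "\<And>s t e. h (pair (pair 9 (pair s t)) e) \<noteq> 0 \<longleftrightarrow> h (pair s e) \<noteq> 0 \<and> h (pair t e) \<noteq> 0"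
    and "\<And>i s e k. h (pair s (env_cons i k e)) \<noteq> 0 \<Longrightarrow> h (pair (pair 10 (pair i s)) e) \<noteq> 0"
    and "\<And>i s e k. h (pair (pair 10 (pair i s)) e) = Suc k \<Longrightarrow> h (pair s (env_cons i k e)) \<noteq> 0"
  shows "consistent (graph h)"
  using assms unfolding consistent_graph violates_def by (auto split: if_splits)

lemma consistent_value:
  assumes cons: "consistent (graph h)"
  shows "h (pair (term_code t) e) = value_of (\<lambda>i a. h (pair (pair 0 i) a)) (env_val e) t"
proof (induction t)
  case (Var i)
  have "h (pair (pair 1 i) (list_encode l)) = env_val (list_encode l) i" for l
  proof (induction l)
    case Nil
    then show ?case
      using consistent_graphD(1)[OF cons] by (simp add: env_val_0)
  next
    case (Cons p l)
    then show ?case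
      using consistent_graphD(2)[OF cons, of i "fst (prod_decode p)" "snd (prod_decode p)" "list_encode l"]
        env_val_cons[of "fst (prod_decode p)" "snd (prod_decode p)" "list_encode l"]
      by (auto simp del: One_nat_def)
  qed
  from this[of "list_decode e"] show ?case
    by simp
qed (simp_all add: consistent_graphD(3-7)[OF cons])

lemma consistent_sat:
  assumes "consistent (graph h)"
  shows "h (pair (form_code \<phi>) e) \<noteq> 0 \<longleftrightarrow> sat (\<lambda>i a. h (pair (pair 0 i) a)) (env_val e) \<phi>"
proof (induction \<phi> arbitrary: e)
  case (Equal s t)
  then show ?case
    using consistent_graphD(8)[OF assms] consistent_value[OF assms] by simp
next
  case (Neg \<phi>)
  then show ?case
    using consistent_graphD(9)[OF assms, of "form_code \<phi>" e]
    unfolding form_code.simps sat.simps by blast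
next
  case (Conj \<phi> \<psi>)
  then show ?case
    using consistent_graphD(10)[OF assms] by simp
next
  case (Exists i \<phi>)
  have *: "h (pair (form_code (Exists i \<phi>)) e) = 0 \<Longrightarrow> h (pair (form_code \<phi>) (env_cons i k e)) = 0"
    "h (pair (form_code (Exists i \<phi>)) e) = Suc k \<Longrightarrow> h (pair (form_code \<phi>) (env_cons i k e)) \<noteq> 0" for k
    using consistent_graphD(11,12)[OF assms] by simp_all
  have "h (pair (form_code (Exists i \<phi>)) e) \<noteq> 0 \<longleftrightarrow> (\<exists>k. h (pair (form_code \<phi>) (env_cons i k e)) \<noteq> 0)"
    using * by (metis not0_implies_Suc)
  then show ?case
    unfolding sat.simps Exists.IH env_val_cons .
qed

section \<open>Existence of correct evaluations\<close>

lemma less_pair: "m \<noteq> 0 \<Longrightarrow> n < pair m n"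
proof -
  have "k \<le> triangle k" for k
    by (induction k) auto
  from this[of "m + n"] show "m \<noteq> 0 \<Longrightarrow> n < pair m n"
    by (simp add: prod_encode_def)
qed

text \<open>The recursion is on numbers and not on syntax, because \<open>consistent\<close> imposes
  its clauses also at numbers that code no term or formula. The environment may grow, but the code
  decreases.\<close>

function eval_code :: "(nat \<Rightarrow> baire) \<Rightarrow> nat \<Rightarrow> nat \<Rightarrow> nat" where
  "eval_code X c e =
    (let g = fst (prod_decode c); p = snd (prod_decode c);
       s = fst (prod_decode p); t = snd (prod_decode p)
     in if g = 0 then X p e
     else if g = 1 then env_val e p
     else if g = 2 then 0
     else if g = 3 then Suc (eval_code X p e)
     else if g = 4 then eval_code X s e + eval_code X t e
     else if g = 5 then eval_code X s e * eval_code X t e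
     else if g = 6 then X s (eval_code X t e)
     else if g = 7 then of_bool (eval_code X s e = eval_code X t e)
     else if g = 8 then of_bool (eval_code X p e = 0)
     else if g = 9 then of_bool (eval_code X s e \<noteq> 0 \<and> eval_code X t e \<noteq> 0)
     else if \<exists>k. eval_code X t (env_cons s k e) \<noteq> 0
       then Suc (LEAST k. eval_code X t (env_cons s k e) \<noteq> 0)
     else 0)"
  by pat_completeness auto

lemma decode_less:
  assumes "fst (prod_decode c) \<noteq> 0"
  shows "snd (prod_decode c) < c" "fst (prod_decode (snd (prod_decode c))) < c"
    "snd (prod_decode (snd (prod_decode c))) < c"
proof -
  show *: "snd (prod_decode c) < c"
    using less_pair[OF assms, of "snd (prod_decode c)"] by simp
  show "fst (prod_decode (snd (prod_decode c))) < c" "snd (prod_decode (snd (prod_decode c))) < c"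
    using le_prod_encode_1[of "fst (prod_decode (snd (prod_decode c)))" "snd (prod_decode (snd (prod_decode c)))"]
      le_prod_encode_2[of "snd (prod_decode (snd (prod_decode c)))" "fst (prod_decode (snd (prod_decode c)))"] *
    by simp_all
qed

termination
  by (relation "measure (\<lambda>(X, c, e). c)") (simp_all add: decode_less)

declare eval_code.simps[simp del]

lemma eval_code_pair:
  "eval_code X (pair 0 p) e = X p e"
  "eval_code X (pair 1 p) e = env_val e p"
  "eval_code X (pair 2 p) e = 0"
  "eval_code X (pair 3 p) e = Suc (eval_code X p e)"
  "eval_code X (pair 4 (pair s t)) e = eval_code X s e + eval_code X t e"
  "eval_code X (pair 5 (pair s t)) e = eval_code X s e * eval_code X t e"
  "eval_code X (pair 6 (pair s t)) e = X s (eval_code X t e)"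
  "eval_code X (pair 7 (pair s t)) e = of_bool (eval_code X s e = eval_code X t e)"
  "eval_code X (pair 8 p) e = of_bool (eval_code X p e = 0)"
  "eval_code X (pair 9 (pair s t)) e = of_bool (eval_code X s e \<noteq> 0 \<and> eval_code X t e \<noteq> 0)"
  "eval_code X (pair 10 (pair s t)) e = (if \<exists>k. eval_code X t (env_cons s k e) \<noteq> 0
       then Suc (LEAST k. eval_code X t (env_cons s k e) \<noteq> 0) else 0)"
  by (subst eval_code.simps; simp)+

lemma consistent_exists:
  obtains h where "consistent (graph h)" "\<And>i a. h (pair (pair 0 i) a) = X i a"
proof
  define h where "h q = eval_code X (fst (prod_decode q)) (snd (prod_decode q))" for q
  have h: "h (pair c e) = eval_code X c e" for c e
    by (simp add: h_def)
  show "h (pair (pair 0 i) a) = X i a" for i a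
    by (simp add: h eval_code_pair)
  show "consistent (graph h)"
    by (rule consistent_graphI; unfold h eval_code_pair env_val_0 env_val_cons)
      (auto intro: LeastI split: if_splits)
qed

text \<open>
  A node \<open>pair r (pair n s)\<close> stands for an attempt to find a correct evaluation that does not vanish
  at \<open>r\<close>: the set with code \<open>s\<close> is the graph of its restriction to the numbers below \<open>n\<close>.
\<close>

definition tree_child :: "nat \<Rightarrow> nat \<Rightarrow> bool" where
  "tree_child u x \<longleftrightarrow> (\<exists>r n s a. x = pair r (pair n s) \<and> u = pair r (pair (Suc n) (s + 2 ^ pair n a))
     \<and> consistent (set_decode (s + 2 ^ pair n a)) \<and> pair r 0 \<notin> set_decode (s + 2 ^ pair n a))"

definition prefix_code :: "baire \<Rightarrow> nat \<Rightarrow> nat" where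
  "prefix_code h n = set_encode ((\<lambda>q. pair q (h q)) ` {..<n})"

lemma prefix_code_0: "prefix_code h 0 = 0"
  by (simp add: prefix_code_def)

lemma prefix_code_Suc: "prefix_code h (Suc n) = prefix_code h n + 2 ^ pair n (h n)"
proof -
  have "pair n (h n) \<notin> (\<lambda>q. pair q (h q)) ` {..<n}"
    by auto
  then show ?thesis
    by (simp add: prefix_code_def lessThan_Suc set_encode_insert)
qed

lemma set_decode_prefix_code: "set_decode (prefix_code h n) = (\<lambda>q. pair q (h q)) ` {..<n}"
  by (simp add: prefix_code_def)

text \<open>A violation involves at most three points, so it lies in a finite restriction of
  \<open>h\<close>.\<close>

lemma consistent_graph_prefix:
  "consistent (graph h) \<longleftrightarrow> (\<forall>n. consistent (set_decode (prefix_code h n)))"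
proof
  assume "consistent (graph h)"
  then show "\<forall>n. consistent (set_decode (prefix_code h n))"
    unfolding consistent_def graph_def set_decode_prefix_code by blast
next
  assume *: "\<forall>n. consistent (set_decode (prefix_code h n))"
  show "consistent (graph h)"
    unfolding consistent_graph
  proof (intro allI)
    fix x y z
    have "x < Suc (x + y + z)" "y < Suc (x + y + z)" "z < Suc (x + y + z)"
      by auto
    with *[rule_format, of "Suc (x + y + z)"]
    show "\<not> violates (pair x (h x)) (pair y (h y)) (pair z (h z))"
      unfolding consistent_def set_decode_prefix_code by blast
  qed
qed

text \<open>The values added along an infinite branch form a function \<open>h\<close> with
  consistent finite parts; conversely the prefixes of such an \<open>h\<close> form an infinite
  branch.\<close>

lemma not_accp_root_iff:
  "\<not> Wellfounded.accp tree_child (pair r 0) \<longleftrightarrow> (\<exists>h. consistent (graph h) \<and> h r \<noteq> 0)"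
proof
  assume root: "\<not> Wellfounded.accp tree_child (pair r 0)"
  have "\<exists>y. \<not> Wellfounded.accp tree_child y \<and> tree_child y x" if "\<not> Wellfounded.accp tree_child x" for x
    using not_accp_down[OF that] by blast
  then have "\<exists>X. \<forall>n. (\<not> Wellfounded.accp tree_child (X n) \<and> (n = 0 \<longrightarrow> X n = pair r 0))
      \<and> tree_child (X (Suc n)) (X n)"
    using root by (intro dependent_nat_choice) auto
  then obtain X where X0: "X 0 = pair r 0" and X: "\<And>n. tree_child (X (Suc n)) (X n)"
    by blast
  \<comment> \<open>This makes \<open>pair r 0\<close> the node with length 0 and empty
    graph.\<close>
  have pair_0: "pair 0 0 = 0"
    by (simp add: prod_encode_def)
  have "\<exists>s. X n = pair r (pair n s)" for n
  proof (induction n)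
    case 0
    show ?case using X0 pair_0 by metis
  next
    case (Suc n)
    then show ?case
      using X[of n] unfolding tree_child_def by auto
  qed
  then obtain s where s: "\<And>n. X n = pair r (pair n (s n))"
    by metis
  have "\<exists>a. s (Suc n) = s n + 2 ^ pair n a \<and> consistent (set_decode (s (Suc n)))
      \<and> pair r 0 \<notin> set_decode (s (Suc n))" for n
    using X[of n] unfolding tree_child_def s by auto
  then obtain h where h: "\<And>n. s (Suc n) = s n + 2 ^ pair n (h n)"
    "\<And>n. consistent (set_decode (s (Suc n)))" "\<And>n. pair r 0 \<notin> set_decode (s (Suc n))"
    by metis
  have "s 0 = 0"
    using X0 pair_0 unfolding s by (metis prod_encode_eq prod.inject)
  then have s_eq: "s n = prefix_code h n" for n
    by (induction n) (simp_all add: prefix_code_0 prefix_code_Suc h(1))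
  have "consistent (set_decode (prefix_code h n))" for n
    using h(2)[of "n - 1"] by (cases n) (simp_all add: s_eq prefix_code_0 consistent_def)
  \<comment> \<open>The value at \<open>r\<close> enters at stage \<open>Suc r\<close>.\<close>
  moreover have "h r \<noteq> 0"
    using h(3)[of r] unfolding s_eq set_decode_prefix_code by auto
  ultimately show "\<exists>h. consistent (graph h) \<and> h r \<noteq> 0"
    unfolding consistent_graph_prefix by blast
next
  assume "\<exists>h. consistent (graph h) \<and> h r \<noteq> 0"
  then obtain h where h: "consistent (graph h)" "h r \<noteq> 0"
    by blast
  have child: "tree_child (pair r (pair (Suc n) (prefix_code h (Suc n)))) (pair r (pair n (prefix_code h n)))" for n
  proof -
    have "consistent (set_decode (prefix_code h (Suc n)))"
      using h(1) unfolding consistent_graph_prefix by blast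
    moreover have "pair r 0 \<notin> set_decode (prefix_code h (Suc n))"
      unfolding set_decode_prefix_code using h(2) by auto
    ultimately show ?thesis
      unfolding tree_child_def prefix_code_Suc by blast
  qed
  have "\<forall>n. x \<noteq> pair r (pair n (prefix_code h n))" if "Wellfounded.accp tree_child x" for x
    using that by (induction rule: accp.induct) (use child in blast)
  moreover have "pair r 0 = pair r (pair 0 (prefix_code h 0))"
    unfolding prefix_code_0 by (simp add: prod_encode_def)
  ultimately show "\<not> Wellfounded.accp tree_child (pair r 0)"
    by blast
qed

text \<open>Completeness of the well-founded part: an evaluation contains an interpretation of the
  function variables, so the quantifier over \<open>X\<close> becomes one over branches.\<close>

lemma accp_root_form:
  "Wellfounded.accp tree_child (pair (pair (form_code \<phi>) e) 0) \<longleftrightarrow> \<not> (\<exists>X. sat X (env_val e) \<phi>)"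
proof -
  have "(\<exists>h. consistent (graph h) \<and> h (pair (form_code \<phi>) e) \<noteq> 0) \<longleftrightarrow> (\<exists>X. sat X (env_val e) \<phi>)"
  proof
    assume "\<exists>X. sat X (env_val e) \<phi>"
    then obtain X where X: "sat X (env_val e) \<phi>" by blast
    obtain h where h: "consistent (graph h)" "\<And>i a. h (pair (pair 0 i) a) = X i a"
      using consistent_exists by blast
    then show "\<exists>h. consistent (graph h) \<and> h (pair (form_code \<phi>) e) \<noteq> 0"
      using X consistent_sat[OF h(1)] by auto
  qed (use consistent_sat in blast)
  then show ?thesis
    using not_accp_root_iff by blast
qed

text \<open>Bit \<open>p\<close> of \<open>s\<close> is set iff the quotient by \<open>2 ^ p\<close>
  is odd. Here \<open>b\<close> is the remainder and \<open>c\<close> witnesses that it is small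
  enough, so that only operations covered by \<open>computable_intros\<close> remain.\<close>

lemma mem_set_decode_iff:
  "p \<in> set_decode s \<longleftrightarrow> (\<exists>a b c. s = Suc (2 * a) * 2 ^ p + b \<and> b + Suc c = 2 ^ p)"
proof
  assume "p \<in> set_decode s"
  then have "odd (s div 2 ^ p)"
    by (simp add: set_decode_def)
  then obtain a where "s div 2 ^ p = Suc (2 * a)"
    by (auto elim: oddE)
  then have "s = Suc (2 * a) * 2 ^ p + s mod 2 ^ p"
    by (metis div_mult_mod_eq)
  moreover have "s mod 2 ^ p < 2 ^ p"
    by simp
  then have "\<exists>c. s mod 2 ^ p + Suc c = 2 ^ p"
    by (metis less_iff_Suc_add add_Suc_right)
  ultimately show "\<exists>a b c. s = Suc (2 * a) * 2 ^ p + b \<and> b + Suc c = 2 ^ p"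
    by blast
next
  assume "\<exists>a b c. s = Suc (2 * a) * 2 ^ p + b \<and> b + Suc c = 2 ^ p"
  then obtain a b c where s: "s = Suc (2 * a) * 2 ^ p + b" and "b + Suc c = 2 ^ p"
    by blast
  then have "b < 2 ^ p" by linarith
  then have "s div 2 ^ p = Suc (2 * a)"
    unfolding s by (intro div_nat_eqI) (simp_all add: algebra_simps)
  then show "p \<in> set_decode s"
    by (simp add: set_decode_def)
qed

lemma decidable_mem_set_decode:
  "computable a \<Longrightarrow> computable b \<Longrightarrow> decidable (\<lambda>v f. a v f \<in> set_decode (b v f))"
proof (rule decidable_subst2[where P = "\<lambda>x y f. x \<in> set_decode y"])
  show "decidable (\<lambda>v f. v 0 \<in> set_decode (v (Suc 0)))"
    unfolding mem_set_decode_iff by (intro computable_intros)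
qed

lemma decidable_violates: "decidable (\<lambda>v f. violates (v i) (v j) (v k))"
  unfolding violates_def by (intro computable_intros)

lemma decidable_consistent:
  "computable a \<Longrightarrow> decidable (\<lambda>v f. consistent (set_decode (a v f)))"
proof (rule decidable_subst1[where P = "\<lambda>x f. consistent (set_decode x)"])
  show "decidable (\<lambda>v f. consistent (set_decode (v 0)))"
    unfolding consistent_def Ball_def
    by (intro computable_intros decidable_violates decidable_mem_set_decode)
qed

lemma decidable_tree_child: "decidable (\<lambda>v f. tree_child (v i) (v j))"
  unfolding tree_child_def
  by (intro computable_intros decidable_mem_set_decode decidable_consistent)


section \<open>Diagonalization\<close>

text \<open>The equation for Cantor pairing is doubled to avoid halving in the triangular
  number.\<close>

definition pair_form :: "aterm \<Rightarrow> aterm \<Rightarrow> aterm \<Rightarrow> aform" where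
  "pair_form s t u =
     Equal (Plus u u) (Plus (Times (Plus s t) (Succ (Plus s t))) (Plus s s))"

lemma sat_pair_form:
  "sat X v (pair_form s t u) \<longleftrightarrow> value_of X v u = pair (value_of X v s) (value_of X v t)"
proof -
  have "n * Suc n = 2 * triangle n" for n
    by (induction n) auto
  then show ?thesis
    by (auto simp: pair_form_def prod_encode_def)
qed

abbreviation let_pair :: "nat \<Rightarrow> aterm \<Rightarrow> aterm \<Rightarrow> aform \<Rightarrow> aform" where
  "let_pair i s t \<phi> \<equiv> Exists i (Conj (pair_form s t (Var i)) \<phi>)"

definition args_env :: "nat \<Rightarrow> nat \<Rightarrow> nat" where
  "args_env m n = env_cons 0 m (env_cons 1 n 0)"

lemma env_val_args_env: "env_val (args_env m n) = (\<lambda>_. 0)(0 := m, 1 := n)"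
  unfolding args_env_def env_val_cons env_val_0 by (rule fun_upd_twist) simp

definition root :: "nat \<Rightarrow> nat \<Rightarrow> nat \<Rightarrow> nat" where
  "root c m n = pair (pair c (args_env m n)) 0"

lemma accp_root:
  "Wellfounded.accp tree_child (root (form_code \<phi>) m n) \<longleftrightarrow> \<not> (\<exists>X. sat X ((\<lambda>_. 0)(0 := m, 1 := n)) \<phi>)"
  unfolding root_def accp_root_form env_val_args_env ..

text \<open>\<open>Succ (Var 5)\<close> and \<open>Succ (Var 6)\<close> are the two stages of
  \<open>args_env\<close>; variables 9 and 10 hold the two roots.\<close>

definition roots_form :: aform where
  "roots_form =
     let_pair 3 Zero (Var 0) (let_pair 4 (Succ Zero) (Var 1) (let_pair 5 (Var 4) Zero
     (let_pair 6 (Var 3) (Succ (Var 5)) (let_pair 7 (Var 0) (Succ (Var 6))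
     (let_pair 8 (Var 1) (Succ (Var 6)) (let_pair 9 (Var 7) Zero (let_pair 10 (Var 8) Zero
     (pair_form (Var 9) (Var 10) (Var 2)))))))))"

lemma sat_roots_form:
  "sat X v roots_form \<longleftrightarrow> v 2 = pair (root (v 0) (v 0) (v 1)) (root (v 1) (v 0) (v 1))"
  by (simp add: roots_form_def sat_pair_form root_def args_env_def)

text \<open>The pair is the argument at which a candidate \<open>g\<close> compares the two roots,
  and 1 is its positive answer.\<close>

lemma Sigma11_roots:
  assumes "Sigma11 R"
  shows "\<exists>\<psi>. \<forall>m n. (\<exists>X. sat X ((\<lambda>_. 0)(0 := m, 1 := n)) \<psi>) \<longleftrightarrow>
    (pair (root m m n) (root n m n), 1) \<in> R"
proof -
  obtain \<phi> where \<phi>: "\<And>m n. (m, n) \<in> R \<longleftrightarrow> (\<exists>X. sat X ((\<lambda>_. 0)(0 := m, 1 := n)) \<phi>)"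
    using assms unfolding Sigma11_def by blast
  \<comment> \<open>The pair is computed in variable 2 and copied to variable 0; variable 1 becomes
    1, and variable 2 is reset because \<open>\<phi>\<close> expects 0 outside its two
    arguments.\<close>
  define \<psi> where "\<psi> = Exists 2 (Conj roots_form (Exists 0 (Conj (Equal (Var 0) (Var 2))
    (Exists 1 (Conj (Equal (Var 1) (Succ Zero)) (Exists 2 (Conj (Equal (Var 2) Zero) \<phi>)))))))"
  have upd: "(\<lambda>_::nat. 0::nat)(0 := m, 1 := n, 2 := k, 0 := k, 1 := Suc 0, 2 := 0) =
      (\<lambda>_. 0)(0 := k, 1 := 1)" for m n k :: nat
    by (auto simp: fun_eq_iff)
  have "sat X ((\<lambda>_. 0)(0 := m, 1 := n)) \<psi> \<longleftrightarrow>
      sat X ((\<lambda>_. 0)(0 := pair (root m m n) (root n m n), 1 := 1)) \<phi>" for X m n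
    unfolding upd[symmetric, of _ m n] by (simp add: \<psi>_def sat_roots_form)
  then show ?thesis
    using \<phi> by (intro exI[of _ \<psi>]) simp
qed

text \<open>If all well-founded points were good, \<open>F\<close> would compare their ranks
  correctly. Let \<open>\<phi>\<close> and \<open>\<psi>\<close> express, for formula codes
  \<open>m\<close> and \<open>n\<close>, that \<open>F\<close> holds or fails between the
  corresponding roots, and apply both to their own codes.\<close>

lemma hyperarithmetical_bad:
  assumes "hyperarithmetical g"
  shows "\<exists>x. Wellfounded.accp tree_child x \<and> bad tree_child (\<lambda>x y. g (pair x y) = 1) x"
proof (rule ccontr)
  define F where "F = (\<lambda>x y. g (pair x y) = 1)"
  assume "\<not> (\<exists>x. Wellfounded.accp tree_child x \<and> bad tree_child (\<lambda>x y. g (pair x y) = 1) x)"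
  then have good: "\<not> bad tree_child F x" if "Wellfounded.accp tree_child x" for x
    using that unfolding F_def by blast
  have agree: "F x y \<longleftrightarrow> rank_le tree_child x y" "F y x \<longleftrightarrow> rank_le tree_child y x"
    if "Wellfounded.accp tree_child x" for x y
    using agree_on_good[of tree_child x "{x. Wellfounded.accp tree_child x}" F] that good
    by (auto intro: accp_downward)
  have S: "Sigma11 {(m, n). g m = n}" "Sigma11 (- {(m, n). g m = n})"
    using assms unfolding hyperarithmetical_def Delta11_def Pi11_def by blast+
  obtain \<phi> where \<phi>: "\<And>m n. (\<exists>X. sat X ((\<lambda>_. 0)(0 := m, 1 := n)) \<phi>) \<longleftrightarrow> F (root m m n) (root n m n)"
    using Sigma11_roots[OF S(1)] unfolding F_def Compl_iff mem_Collect_eq prod.case by blast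
  obtain \<psi> where \<psi>: "\<And>m n. (\<exists>X. sat X ((\<lambda>_. 0)(0 := m, 1 := n)) \<psi>) \<longleftrightarrow> \<not> F (root m m n) (root n m n)"
    using Sigma11_roots[OF S(2)] unfolding F_def Compl_iff mem_Collect_eq prod.case by blast
  define x where "x = root (form_code \<phi>) (form_code \<phi>) (form_code \<psi>)"
  define y where "y = root (form_code \<psi>) (form_code \<phi>) (form_code \<psi>)"
  have x: "Wellfounded.accp tree_child x \<longleftrightarrow> \<not> F x y" and y: "Wellfounded.accp tree_child y \<longleftrightarrow> F x y"
    unfolding x_def y_def accp_root \<phi> \<psi> by simp_all
  \<comment> \<open>Exactly one root is well-founded. By agreement there, \<open>F x y\<close> would
    make \<open>x\<close> well-founded, and its failure would make \<open>y\<close>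
    well-founded.\<close>
  show False
  proof (cases "F x y")
    case True
    then show False
      using x y agree(2)[of y x] rank_le_accp[of tree_child x y] by blast
  next
    case False
    then obtain u where u: "tree_child u x" "rank_le tree_child y u"
      using x agree(1)[of x y] rank_le_or_less[of tree_child x y] by blast
    then show False
      using False y rank_le_accp[of tree_child y u] by blast
  qed
qed


section \<open>The functional\<close>

text \<open>The successor puts the position \<open>pair x y\<close> inside an initial segment of
  length \<open>n\<close>.\<close>

definition mismatch :: "nat \<Rightarrow> baire \<Rightarrow> bool" where
  "mismatch n g \<longleftrightarrow> (\<exists>x y. n = Suc (pair x y) \<and> fails tree_child (\<lambda>x y. g (pair x y) = 1) x y
     \<and> (pivot tree_child (\<lambda>x y. g (pair x y) = 1) x \<or> pivot tree_child (\<lambda>x y. g (pair x y) = 1) y))"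

lemma decidable_mismatch: "decidable (\<lambda>v g. mismatch (v i) g)"
  unfolding mismatch_def fails_def pivot_def bad_def rank_step_def
  by (intro computable_intros decidable_tree_child)

theorem corollary6p8:
  fixes \<Theta> :: "type2 \<Rightarrow> baire list"
  assumes "SFF \<Theta>"
  shows "\<exists>G. computable_in G E2 \<and> \<not> hyperarithmetical_seq (\<Theta> G)"
proof -
  \<comment> \<open>The second disjunct makes the search total, with value 0 if there is no
    mismatch.\<close>
  define G :: type2 where "G g = (LEAST n. mismatch n g \<or> \<not> (\<exists>m. mismatch m g))" for g
  define X where
    "X p = (if rank_le tree_child (fst (prod_decode p)) (snd (prod_decode p)) then 1 else 0 :: nat)" for p
  have "computable_in G E2"
    unfolding G_def
    by (intro computable_in_Least computable_intros decidable_mismatch) blast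
  moreover have "X \<in> cantor"
    by (simp add: cantor_def X_def)
  then obtain g where "g \<in> set (\<Theta> G)" and g: "X \<in> neighbourhood (initial_segment g (G g))"
    using assms unfolding SFF_def by blast
  moreover have "\<not> hyperarithmetical g"
  proof
    assume "hyperarithmetical g"
    then obtain z where z: "Wellfounded.accp tree_child z"
        "bad tree_child (\<lambda>x y. g (pair x y) = 1) z"
      using hyperarithmetical_bad by blast
    have "\<exists>n. mismatch n g"
      using pivot_exists[OF z] unfolding mismatch_def by blast
    then have "mismatch (G g) g"
      unfolding G_def by (metis (mono_tags, lifting) LeastI)
    then obtain x y where xy: "G g = Suc (pair x y)"
        "(g (pair x y) = 1) \<noteq> rank_le tree_child x y"
      unfolding mismatch_def using pivot_fails[OF z] by blast
    \<comment> \<open>\<open>X\<close> takes the value 1 exactly where \<open>rank_le\<close> holds,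
      so \<open>g\<close>, wrong about \<open>rank_le\<close> here, has a different value.\<close>
    then have "X (pair x y) \<noteq> g (pair x y)"
      by (auto simp: X_def)
    then show False
      using g xy(1) by (simp add: neighbourhood_def initial_segment_def del: upt_Suc)
  qed
  ultimately show ?thesis
    unfolding hyperarithmetical_seq_def by blast
qed

end
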